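(* For every $n\ge2$ and all positive integers $a$ and $b$, the caracol graph $\mathrm{Car}_{n+1}$ satisfies $$\operatorname{vol}\mathcal{F}_{\mathrm{Car}_{n+1}}(a,b,\ldots,b)=C_{n-2}\cdot a^{n-2}\big(a+(n-1)b\big)^{n-2},$$ where $(a,b,\ldots,b)\in\mathbb{Z}^n$ and $C_k=\frac{1}{k+1}\binom{2k}{k}$.
   Context: The caracol graph $\mathrm{Car}_{n+1}$ is the directed graph on $\{1,\ldots,n+1\}$ with edges $(1,j)$ for $2\le j\le n$, $(i,i+1)$ for $2\le i\le n$, and $(i,n+1)$ for $2\le i\le n-1$ (so $m=3n-4$ edges). For a connected directed graph $G$ on $[n+1]$ with $m$ edges, each directed from smaller to larger vertex, and $\mathbf{a}\in\mathbb{Z}^n$, the flow polytope $\mathcal{F}_G(\mathbf{a})\subset\mathbb{R}^m$ is the set of tuples $(b_e)_{e\in E(G)}$ of nonnegative reals such that for each $j=1,\ldots,n$, (sum of $b_e$ over edges leaving $j$) minus (sum of $b_e$ over edges entering $j$) equals $a_j$. It lies in an affine subspace of dimension $m-n$, and $\operatorname{vol}$ is normalized volume: $(m-n)!$ times the $(m-n)$-dimensional volume, normalized so that a fundamental cell of the lattice of integer points of the linear subspace parallel to this affine subspace has volume $1$. *)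

theory Defs
  imports "HOL-Analysis.Analysis" "Graph_Theory.Digraph"
begin

definition caracol :: "nat \<Rightarrow> (nat, nat \<times> nat) pre_digraph" where
  "caracol n =
     \<lparr> verts = {1..n + 1},
       arcs = {(1, j) | j. 2 \<le> j \<and> j \<le> n}
            \<union> {(i, i + 1) | i. 2 \<le> i \<and> i \<le> n}
            \<union> {(i, n + 1) | i. 2 \<le> i \<and> i + 1 \<le> n},
       tail = fst,
       head = snd \<rparr>"

text \<open>
  Throughout, \<open>G\<close> is meant to be a digraph with vertex set \<open>{1..n + 1}\<close>, and \<open>\<real>\<^sup>m\<close> is the set
  of real functions on its arc set, i.e. \<open>arcs G \<rightarrow>\<^sub>E UNIV\<close>.  Balance is imposed at the vertices
  \<open>1, \<dots>, n\<close> only (at \<open>n + 1\<close> it follows, with net flow \<open>- (a 1 + \<dots> + a n)\<close>); the values of \<open>a\<close>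
  outside \<open>{1..n}\<close> are irrelevant.
\<close>

definition netflow :: "('a, 'e) pre_digraph \<Rightarrow> ('e \<Rightarrow> real) \<Rightarrow> 'a \<Rightarrow> real" where
  "netflow G x j = (\<Sum>e\<in>out_arcs G j. x e) - (\<Sum>e\<in>in_arcs G j. x e)"

definition flow_space :: "nat \<Rightarrow> (nat, 'e) pre_digraph \<Rightarrow> (nat \<Rightarrow> int) \<Rightarrow> ('e \<Rightarrow> real) set" where
  "flow_space n G a = {x \<in> arcs G \<rightarrow>\<^sub>E UNIV. \<forall>j\<in>{1..n}. netflow G x j = of_int (a j)}"

definition flow_polytope :: "nat \<Rightarrow> (nat, 'e) pre_digraph \<Rightarrow> (nat \<Rightarrow> int) \<Rightarrow> ('e \<Rightarrow> real) set" where
  "flow_polytope n G a = {x \<in> flow_space n G a. \<forall>e\<in>arcs G. 0 \<le> x e}"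

text \<open>The integer points of the linear subspace parallel to \<open>flow_space n G a\<close>.\<close>

definition flow_lattice :: "nat \<Rightarrow> (nat, 'e) pre_digraph \<Rightarrow> ('e \<Rightarrow> real) set" where
  "flow_lattice n G = {x \<in> flow_space n G (\<lambda>_. 0). \<forall>e\<in>arcs G. x e \<in> \<int>}"

definition lin_comb :: "'e set \<Rightarrow> nat \<Rightarrow> (nat \<Rightarrow> 'e \<Rightarrow> real) \<Rightarrow> (nat \<Rightarrow> real) \<Rightarrow> 'e \<Rightarrow> real" where
  "lin_comb E d v t = (\<lambda>e\<in>E. \<Sum>k<d. t k * v k e)"

text \<open>\<open>v 0, \<dots>, v (d - 1)\<close> is a \<open>\<int>\<close>-basis of the lattice \<open>L \<subseteq> \<int>\<^sup>E\<close>.\<close>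

definition lattice_basis ::
    "'e set \<Rightarrow> nat \<Rightarrow> ('e \<Rightarrow> real) set \<Rightarrow> (nat \<Rightarrow> 'e \<Rightarrow> real) \<Rightarrow> bool" where
  "lattice_basis E d L v \<longleftrightarrow>
     (\<forall>k<d. v k \<in> L) \<and> (\<forall>x\<in>L. \<exists>!c. c \<in> {..<d} \<rightarrow>\<^sub>E \<int> \<and> x = lin_comb E d v c)"

text \<open>
  Normalized volume of a set \<open>P\<close> of functions on \<open>E\<close> contained in a translate of the real span of
  a lattice \<open>L\<close> of rank \<open>d\<close>.  In the affine coordinates \<open>t \<mapsto> p + (\<Sum>k<d. t k * v k)\<close>, with \<open>v\<close> a
  basis of \<open>L\<close> and \<open>p \<in> P\<close>, the fundamental cell spanned by \<open>v\<close> becomes the unit cube; hence the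
  \<open>d\<close>-dimensional volume giving the cells of \<open>L\<close> volume \<open>1\<close> is Lebesgue measure in these
  coordinates.  The value does not depend on the choice of \<open>v\<close> (base changes are unimodular) or
  of \<open>p\<close>.  It is \<open>0\<close> for \<open>P = {}\<close>.
\<close>

definition normalized_volume ::
    "'e set \<Rightarrow> nat \<Rightarrow> ('e \<Rightarrow> real) set \<Rightarrow> ('e \<Rightarrow> real) set \<Rightarrow> real" where
  "normalized_volume E d L P =
     (let v = (SOME v. lattice_basis E d L v);
          p = (SOME p. p \<in> P)
      in fact d * measure (Pi\<^sub>M {..<d} (\<lambda>_. lborel))
           {t \<in> {..<d} \<rightarrow>\<^sub>E UNIV. (\<lambda>e\<in>E. p e + lin_comb E d v t e) \<in> P})"

definition flow_polytope_volume :: "nat \<Rightarrow> (nat, 'e) pre_digraph \<Rightarrow> (nat \<Rightarrow> int) \<Rightarrow> real" where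
  "flow_polytope_volume n G a =
     normalized_volume (arcs G) (card (arcs G) - n) (flow_lattice n G) (flow_polytope n G a)"

definition catalan :: "nat \<Rightarrow> real" where
  "catalan k = 1 / (real k + 1) * real ((2 * k) choose k)"

lemma card_arcs_caracol:
  assumes "n \<ge> 2"
  shows "card (arcs (caracol n)) = 3 * n - 4"
proof -
  have eq: "arcs (caracol n) =
      (\<lambda>j. (1, j)) ` {2..n} \<union> ((\<lambda>i. (i, i + 1)) ` {2..n} \<union> (\<lambda>i. (i, n + 1)) ` {2..<n})"
    by (auto simp: caracol_def)
  have "card ((\<lambda>i. (i, i + 1)) ` {2..n} \<union> (\<lambda>i. (i, n + 1)) ` {2..<n}) = (n - 1) + (n - 2)"
    by (subst card_Un_disjoint) (auto simp: card_image inj_on_def)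
  then show ?thesis
    unfolding eq using assms
    by (subst card_Un_disjoint) (auto simp: card_image inj_on_def)
qed

lemma digraph_caracol: "digraph (caracol n)"
proof -
  have "arcs (caracol n) \<subseteq> {1..n + 1} \<times> {1..n + 1}"
    by (auto simp: caracol_def)
  then have "finite (arcs (caracol n))"
    by (rule finite_subset) auto
  then show ?thesis
    by unfold_locales (auto simp: caracol_def arc_to_ends_def)
qed

end

theory Submission
  imports Defs
begin

text \<open>
  A flow on the caracol graph is determined by the flows \<open>x\<^sub>i\<close> on \<open>(1, i)\<close> and \<open>y\<^sub>i\<close> on \<open>(i, i + 1)\<close>
  for \<open>2 \<le> i < n\<close>, and it is nonnegative iff these are, \<open>\<Sum> x\<^sub>i \<le> a\<close>, and \<open>y\<^sub>i \<le> b + x\<^sub>i + y\<^sub>i\<^sub>-\<^sub>1\<close>.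
  Integrating over \<open>y\<^sub>i\<close> and \<open>x\<^sub>i\<close> in turn gives the recursion
  \<open>V (k + 1) A y = \<integral>\<^sub>0\<^sup>A \<integral>\<^sub>0\<^sup>b\<^sup>+\<^sup>x\<^sup>+\<^sup>y V k (A - x) y' dy' dx\<close>, which is solved by
  \<open>V k A y = A ^ k / (k!)\<^sup>2 * (A + y + (k + 1) b) ^ (k - 1) * (y + b + A / (k + 1))\<close>.

  The lattice basis in the definition of the volume is arbitrary.  Its transition matrix to the
  basis given by the coordinates \<open>x\<^sub>i\<close>, \<open>y\<^sub>i\<close> is integral with an integral inverse, and such a map
  preserves Lebesgue measure: by translation invariance it scales measure by a constant, and the
  constant is \<open>1\<close> because the preimage of the unit cube is a fundamental domain of the same lattice.
\<close>

subsection \<open>Unimodular maps and Lebesgue measure\<close>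

abbreviation lborel_fun :: "'i set \<Rightarrow> ('i \<Rightarrow> real) measure" where
  "lborel_fun I \<equiv> Pi\<^sub>M I (\<lambda>_. lborel)"

definition fun_add :: "'i set \<Rightarrow> ('i \<Rightarrow> real) \<Rightarrow> ('i \<Rightarrow> real) \<Rightarrow> 'i \<Rightarrow> real" where
  "fun_add I x y = (\<lambda>i\<in>I. x i + y i)"

definition lin_map :: "'i set \<Rightarrow> ('i \<Rightarrow> 'i \<Rightarrow> real) \<Rightarrow> ('i \<Rightarrow> real) \<Rightarrow> 'i \<Rightarrow> real" where
  "lin_map I M t = (\<lambda>j\<in>I. \<Sum>k\<in>I. t k * M k j)"

text \<open>Matrices act on row vectors, so this condition makes \<open>lin_map I N\<close> a left
  inverse of \<open>lin_map I M\<close>. Assumed in both orders, it expresses unimodularity without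
  determinants.\<close>

definition int_inverse :: "'i set \<Rightarrow> ('i \<Rightarrow> 'i \<Rightarrow> real) \<Rightarrow> ('i \<Rightarrow> 'i \<Rightarrow> real) \<Rightarrow> bool" where
  "int_inverse I M N \<longleftrightarrow> (\<forall>i\<in>I. \<forall>j\<in>I. M i j \<in> \<int> \<and> N i j \<in> \<int> \<and>
     (\<Sum>k\<in>I. M i k * N k j) = (if i = j then 1 else 0))"

lemma space_lborel_fun: "space (lborel_fun I) = I \<rightarrow>\<^sub>E UNIV"
  by (simp add: space_PiM)

lemma product_sigma_finite_lborel: "product_sigma_finite (\<lambda>_. lborel)"
  by (simp add: product_sigma_finite_def sigma_finite_lborel)

lemma pair_sigma_finite_lborel_fun:
  "finite I \<Longrightarrow> pair_sigma_finite (lborel_fun I) (lborel_fun I)"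
  by (intro pair_sigma_finite.intro product_sigma_finite.sigma_finite
        product_sigma_finite_lborel)

lemma measurable_fun_add [measurable (raw)]:
  assumes "f \<in> measurable P (lborel_fun I)" "g \<in> measurable P (lborel_fun I)"
  shows "(\<lambda>x. fun_add I (f x) (g x)) \<in> measurable P (lborel_fun I)"
  unfolding fun_add_def
proof (rule measurable_restrict)
  fix i assume i: "i \<in> I"
  have "(\<lambda>x. f x i) \<in> measurable P lborel" "(\<lambda>x. g x i) \<in> measurable P lborel"
    using measurable_compose[OF assms(1) measurable_component_singleton[OF i]]
      measurable_compose[OF assms(2) measurable_component_singleton[OF i]] by auto
  then show "(\<lambda>x. f x i + g x i) \<in> measurable P lborel" by simp
qed

lemma measurable_lin_map [measurable (raw)]:
  assumes "f \<in> measurable P (lborel_fun I)"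
  shows "(\<lambda>x. lin_map I M (f x)) \<in> measurable P (lborel_fun I)"
  unfolding lin_map_def
proof (rule measurable_restrict)
  fix j assume "j \<in> I"
  have "(\<lambda>x. f x i) \<in> borel_measurable P" if "i \<in> I" for i
    using measurable_compose[OF assms(1) measurable_component_singleton[OF that]] by auto
  then have "(\<lambda>x. \<Sum>k\<in>I. f x k * M k j) \<in> borel_measurable P"
    by (intro borel_measurable_sum borel_measurable_times) auto
  then show "(\<lambda>x. \<Sum>k\<in>I. f x k * M k j) \<in> measurable P lborel" by simp
qed

lemma fun_add_in_PiE [simp]: "fun_add I x y \<in> I \<rightarrow>\<^sub>E UNIV"
  by (auto simp: fun_add_def)

lemma lin_map_in_PiE [simp]: "lin_map I M x \<in> I \<rightarrow>\<^sub>E UNIV"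
  by (auto simp: lin_map_def)

lemma PiE_UNIV_of_PiE: "x \<in> Pi\<^sub>E I A \<Longrightarrow> x \<in> I \<rightarrow>\<^sub>E UNIV"
  by (auto simp: PiE_def)

lemma emeasure_vimage_PiE:
  assumes f: "f \<in> measurable (lborel_fun I) (lborel_fun I)" and A: "A \<in> sets (lborel_fun I)"
  shows "emeasure (lborel_fun I) {x \<in> I \<rightarrow>\<^sub>E UNIV. f x \<in> A} = (\<integral>\<^sup>+x. indicator A (f x) \<partial>lborel_fun I)"
proof -
  have eq: "{x \<in> I \<rightarrow>\<^sub>E UNIV. f x \<in> A} = f -` A \<inter> space (lborel_fun I)"
    by (auto simp: space_lborel_fun)
  then have "{x \<in> I \<rightarrow>\<^sub>E UNIV. f x \<in> A} \<in> sets (lborel_fun I)"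
    using measurable_sets[OF f A] by simp
  then have "emeasure (lborel_fun I) {x \<in> I \<rightarrow>\<^sub>E UNIV. f x \<in> A} =
      (\<integral>\<^sup>+x. indicator {x \<in> I \<rightarrow>\<^sub>E UNIV. f x \<in> A} x \<partial>lborel_fun I)"
    by (rule nn_integral_indicator[symmetric])
  also have "\<dots> = (\<integral>\<^sup>+x. indicator A (f x) \<partial>lborel_fun I)"
    by (intro nn_integral_cong) (auto simp: space_lborel_fun indicator_def)
  finally show ?thesis .
qed

lemma lin_map_fun_add: "lin_map I M (fun_add I x y) = fun_add I (lin_map I M x) (lin_map I M y)"
  by (auto simp: lin_map_def fun_add_def algebra_simps sum.distrib)

lemma lin_map_uminus: "lin_map I (\<lambda>i j. - M i j) x = (\<lambda>i\<in>I. - lin_map I M x i)"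
  by (auto simp: lin_map_def sum_negf)

lemma lin_map_inverse:
  assumes "finite I" "int_inverse I M N" "x \<in> I \<rightarrow>\<^sub>E UNIV"
  shows "lin_map I N (lin_map I M x) = x"
proof
  fix j
  show "lin_map I N (lin_map I M x) j = x j"
  proof (cases "j \<in> I")
    case True
    have "lin_map I N (lin_map I M x) j = (\<Sum>k\<in>I. (\<Sum>i\<in>I. x i * M i k) * N k j)"
      using True by (simp add: lin_map_def)
    also have "\<dots> = (\<Sum>i\<in>I. x i * (\<Sum>k\<in>I. M i k * N k j))"
      unfolding sum_distrib_left sum_distrib_right by (subst sum.swap) (simp add: mult.assoc)
    also have "\<dots> = (\<Sum>i\<in>I. if i = j then x i else 0)"
      using assms(2) True by (intro sum.cong) (auto simp: int_inverse_def)
    also have "\<dots> = x j" using True assms(1) by simp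
    finally show ?thesis .
  qed (use assms(3) in \<open>auto simp: lin_map_def PiE_def extensional_def\<close>)
qed

lemma lin_map_Ints:
  assumes "int_inverse I M N" "x \<in> I \<rightarrow>\<^sub>E \<int>"
  shows "lin_map I M x \<in> I \<rightarrow>\<^sub>E \<int>"
  using assms by (auto simp: lin_map_def int_inverse_def intro!: Ints_sum Ints_mult)

section \<open>Translation invariance and tilings by the unit cube\<close>

lemma measurable_fun_add_const [measurable]:
  "fun_add I c \<in> measurable (lborel_fun I) (lborel_fun I)"
proof -
  \<comment> \<open>\<open>c\<close> may be any function; only its restriction to \<open>I\<close>
    is a point of the product space.\<close>
  have "fun_add I c = fun_add I (\<lambda>i\<in>I. c i)" by (auto simp: fun_add_def fun_eq_iff)
  moreover have "fun_add I (\<lambda>i\<in>I. c i) \<in> measurable (lborel_fun I) (lborel_fun I)"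
    by (rule measurable_fun_add) (auto simp: space_lborel_fun)
  ultimately show ?thesis by simp
qed

text \<open>The product measure is determined by its values on boxes, and a translation pulls a box
  back to a box whose sides are shifted separately.\<close>

lemma distr_lborel_fun_add:
  assumes "finite I"
  shows "distr (lborel_fun I) (lborel_fun I) (fun_add I c) = lborel_fun I"
proof (rule product_sigma_finite.PiM_eqI[OF product_sigma_finite_lborel assms])
  fix A :: "_ \<Rightarrow> real set" assume A: "\<And>i. i \<in> I \<Longrightarrow> A i \<in> sets lborel"
  have sh: "(+) (c i) -` A i \<in> sets lborel \<and> emeasure lborel ((+) (c i) -` A i) = emeasure lborel (A i)"
    if "i \<in> I" for i
  proof -
    have m: "(+) (c i) \<in> measurable lborel lborel" by simp
    have "emeasure lborel (A i) = emeasure (distr lborel borel ((+) (c i))) (A i)"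
      by (simp add: lborel_distr_plus)
    also have "\<dots> = emeasure lborel ((+) (c i) -` A i)"
      using A[OF that] by (subst emeasure_distr) auto
    finally show ?thesis using measurable_sets[OF m A[OF that]] by simp
  qed
  have "emeasure (distr (lborel_fun I) (lborel_fun I) (fun_add I c)) (Pi\<^sub>E I A) =
      emeasure (lborel_fun I) (fun_add I c -` Pi\<^sub>E I A \<inter> space (lborel_fun I))"
    by (rule emeasure_distr[OF measurable_fun_add_const]) (use A assms in \<open>auto intro!: sets_PiM_I_finite\<close>)
  also have "fun_add I c -` Pi\<^sub>E I A \<inter> space (lborel_fun I) = Pi\<^sub>E I (\<lambda>i. (+) (c i) -` A i)"
    by (auto simp: space_lborel_fun fun_add_def PiE_iff)
  also have "emeasure (lborel_fun I) \<dots> = (\<Prod>i\<in>I. emeasure lborel (A i))"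
    using sh assms by (subst product_sigma_finite.emeasure_PiM[OF product_sigma_finite_lborel]) auto
  finally show "emeasure (distr (lborel_fun I) (lborel_fun I) (fun_add I c)) (Pi\<^sub>E I A) =
      (\<Prod>i\<in>I. emeasure lborel (A i))" .
qed simp

lemma nn_integral_fun_add:
  assumes "finite I" "f \<in> borel_measurable (lborel_fun I)"
  shows "(\<integral>\<^sup>+x. f (fun_add I c x) \<partial>lborel_fun I) = (\<integral>\<^sup>+x. f x \<partial>lborel_fun I)"
proof -
  have "(\<integral>\<^sup>+x. f x \<partial>lborel_fun I) = (\<integral>\<^sup>+x. f x \<partial>distr (lborel_fun I) (lborel_fun I) (fun_add I c))"
    by (simp add: distr_lborel_fun_add assms)
  also have "\<dots> = (\<integral>\<^sup>+x. f (fun_add I c x) \<partial>lborel_fun I)"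
    using assms(2) by (intro nn_integral_distr measurable_fun_add_const) auto
  finally show ?thesis ..
qed

text \<open>Half-open sides make the integer translates of the cube tile the space without
  overlaps.\<close>

definition unit_cube :: "'i set \<Rightarrow> ('i \<Rightarrow> real) set" where
  "unit_cube I = (\<Pi>\<^sub>E i\<in>I. {0..<1})"

lemma unit_cube_sets [measurable]: "finite I \<Longrightarrow> unit_cube I \<in> sets (lborel_fun I)"
  by (auto simp: unit_cube_def intro!: sets_PiM_I_finite)

lemma emeasure_unit_cube: "finite I \<Longrightarrow> emeasure (lborel_fun I) (unit_cube I) = 1"
  by (simp add: unit_cube_def product_sigma_finite.emeasure_PiM[OF product_sigma_finite_lborel])

lemma ex1_translate_unit_cube:
  assumes "x \<in> I \<rightarrow>\<^sub>E UNIV"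
  shows "\<exists>!z. z \<in> I \<rightarrow>\<^sub>E \<int> \<and> fun_add I z x \<in> unit_cube I"
proof (rule ex_ex1I)
  show "\<exists>z. z \<in> I \<rightarrow>\<^sub>E \<int> \<and> fun_add I z x \<in> unit_cube I"
    by (rule exI[of _ "\<lambda>i\<in>I. - of_int \<lfloor>x i\<rfloor>"])
      (auto simp: fun_add_def unit_cube_def; linarith)
next
  fix z w
  assume z: "z \<in> I \<rightarrow>\<^sub>E \<int> \<and> fun_add I z x \<in> unit_cube I"
    and w: "w \<in> I \<rightarrow>\<^sub>E \<int> \<and> fun_add I w x \<in> unit_cube I"
  show "z = w"
  proof
    fix i show "z i = w i"
    proof (cases "i \<in> I")
      case True
      then obtain p q where pq: "z i = of_int p" "w i = of_int q"
        using z w by (meson Ints_cases PiE_mem)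
      moreover have "0 \<le> z i + x i" "z i + x i < 1" "0 \<le> w i + x i" "w i + x i < 1"
        using z w True by (auto simp: fun_add_def unit_cube_def PiE_iff)
      ultimately have "real_of_int p < of_int (q + 1)" "real_of_int q < of_int (p + 1)"
        by simp_all
      then have "p = q" unfolding of_int_less_iff by linarith
      then show ?thesis using pq by simp
    qed (use z w in \<open>auto simp: PiE_def extensional_def\<close>)
  qed
qed

lemma emeasure_fun_add_vimage:
  assumes "finite I" "A \<in> sets (lborel_fun I)"
  shows "emeasure (lborel_fun I) {x \<in> I \<rightarrow>\<^sub>E UNIV. fun_add I c x \<in> A} = emeasure (lborel_fun I) A"
proof -
  have "emeasure (lborel_fun I) A = emeasure (distr (lborel_fun I) (lborel_fun I) (fun_add I c)) A"
    by (simp add: distr_lborel_fun_add assms)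
  also have "\<dots> = emeasure (lborel_fun I) {x \<in> I \<rightarrow>\<^sub>E UNIV. fun_add I c x \<in> A}"
    using assms by (subst emeasure_distr) (auto simp: space_lborel_fun intro!: arg_cong2[where f=emeasure])
  finally show ?thesis by simp
qed

text \<open>The preimage of the unit cube is another fundamental domain for the translations by integer
  points, so it can be cut along the integer translates of the cube and reassembled to the cube.\<close>

lemma emeasure_lin_map_vimage_unit_cube:
  assumes fin: "finite I" and MN: "int_inverse I M N" and NM: "int_inverse I N M"
  shows "emeasure (lborel_fun I) {x \<in> I \<rightarrow>\<^sub>E UNIV. lin_map I M x \<in> unit_cube I} = 1"
proof -
  let ?L = "lborel_fun I" and ?Z = "I \<rightarrow>\<^sub>E (\<int> :: real set)"
  define P where "P = {x \<in> I \<rightarrow>\<^sub>E UNIV. lin_map I M x \<in> unit_cube I}"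
  have cnt: "countable ?Z"
    using fin by (intro countable_PiE) (auto simp: Ints_def)
  have P [measurable]: "P \<in> sets ?L"
  proof -
    have "P = lin_map I M -` unit_cube I \<inter> space ?L" by (auto simp: P_def space_lborel_fun)
    also have "\<dots> \<in> sets ?L"
      by (rule measurable_sets[OF measurable_lin_map unit_cube_sets]) (use fin in auto)
    finally show ?thesis .
  qed
  \<comment> \<open>\<open>A z\<close> is the piece of \<open>P\<close> that translation by
    \<open>z\<close> carries into the cube, and \<open>B z\<close> the piece of the cube that it
    carries into \<open>P\<close>. Over all integral \<open>z\<close> these pieces partition
    \<open>P\<close> and the cube.\<close>
  define A where "A z = {x \<in> I \<rightarrow>\<^sub>E UNIV. x \<in> P \<and> fun_add I z x \<in> unit_cube I}" for z
  define B where "B z = {x \<in> I \<rightarrow>\<^sub>E UNIV. x \<in> unit_cube I \<and> fun_add I z x \<in> P}" for z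
  have meas: "{x \<in> I \<rightarrow>\<^sub>E UNIV. x \<in> U \<and> fun_add I z x \<in> V} \<in> sets ?L"
    if "U \<in> sets ?L" "V \<in> sets ?L" for z U V
  proof -
    have "{x \<in> I \<rightarrow>\<^sub>E UNIV. x \<in> U \<and> fun_add I z x \<in> V} = U \<inter> (fun_add I z -` V \<inter> space ?L)"
      using sets.sets_into_space[OF that(1)] by (auto simp: space_lborel_fun)
    also have "\<dots> \<in> sets ?L"
      using that by (intro sets.Int measurable_sets[OF measurable_fun_add_const])
    finally show ?thesis .
  qed
  have uA: "\<exists>!z. z \<in> ?Z \<and> fun_add I z x \<in> unit_cube I" if "x \<in> P" for x
    using that by (intro ex1_translate_unit_cube) (auto simp: P_def)
  \<comment> \<open>\<open>lin_map I M\<close> permutes the integer points and turns a translation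
    of \<open>x\<close> into \<open>P\<close> into a translation of \<open>lin_map I M x\<close>
    into the cube, so existence and uniqueness carry over.\<close>
  have uB: "\<exists>!z. z \<in> ?Z \<and> fun_add I z x \<in> P" if "x \<in> unit_cube I" for x
  proof -
    have ex1: "\<exists>!z. z \<in> ?Z \<and> fun_add I z (lin_map I M x) \<in> unit_cube I"
      by (rule ex1_translate_unit_cube) simp
    then obtain w where w: "w \<in> ?Z" "fun_add I w (lin_map I M x) \<in> unit_cube I" by auto
    have "lin_map I N w \<in> ?Z \<and> fun_add I (lin_map I N w) x \<in> P"
      using w lin_map_Ints[OF NM w(1)] lin_map_inverse[OF fin NM PiE_UNIV_of_PiE[OF w(1)]]
      by (auto simp: P_def lin_map_fun_add)
    moreover have "z = lin_map I N w" if "z \<in> ?Z \<and> fun_add I z x \<in> P" for z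
    proof -
      have "lin_map I M z \<in> ?Z \<and> fun_add I (lin_map I M z) (lin_map I M x) \<in> unit_cube I"
        using that lin_map_Ints[OF MN] by (auto simp: P_def lin_map_fun_add)
      then have "lin_map I M z = w" using ex1 w by auto
      then show ?thesis using lin_map_inverse[OF fin MN PiE_UNIV_of_PiE] that by auto
    qed
    ultimately show ?thesis by (rule ex1I)
  qed
  \<comment> \<open>Translation by \<open>z\<close> carries \<open>A z\<close> onto the piece of the
    cube that translation by the negative of \<open>z\<close> carries back into
    \<open>P\<close>.\<close>
  have AB: "emeasure ?L (A z) = emeasure ?L (B (\<lambda>i\<in>I. - z i))" if "z \<in> ?Z" for z
  proof -
    have "emeasure ?L (B (\<lambda>i\<in>I. - z i)) =
        emeasure ?L {x \<in> I \<rightarrow>\<^sub>E UNIV. fun_add I z x \<in> B (\<lambda>i\<in>I. - z i)}"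
      by (rule emeasure_fun_add_vimage[symmetric])
        (use fin P meas in \<open>auto simp: B_def\<close>)
    also have "{x \<in> I \<rightarrow>\<^sub>E UNIV. fun_add I z x \<in> B (\<lambda>i\<in>I. - z i)} = A z"
    proof -
      have "fun_add I (\<lambda>i\<in>I. - z i) (fun_add I z x) = x" if "x \<in> I \<rightarrow>\<^sub>E UNIV" for x
        using that by (auto simp: fun_add_def fun_eq_iff PiE_def extensional_def)
      then show ?thesis by (auto simp: A_def B_def)
    qed
    finally show ?thesis ..
  qed
  have neg: "bij_betw (\<lambda>z. \<lambda>i\<in>I. - z i) ?Z ?Z"
    by (rule bij_betwI[where g = "\<lambda>z. \<lambda>i\<in>I. - z i"])
      (auto simp: fun_eq_iff PiE_def extensional_def)
  have PA: "P = (\<Union>z\<in>?Z. A z)"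
  proof (intro equalityI subsetI)
    fix x assume x: "x \<in> P"
    then obtain z where "z \<in> ?Z" "fun_add I z x \<in> unit_cube I" using uA by blast
    then show "x \<in> (\<Union>z\<in>?Z. A z)" using x by (auto simp: A_def P_def)
  qed (auto simp: A_def)
  have QB: "unit_cube I = (\<Union>z\<in>?Z. B z)"
  proof (intro equalityI subsetI)
    fix x assume x: "x \<in> unit_cube I"
    then have "x \<in> I \<rightarrow>\<^sub>E UNIV" unfolding unit_cube_def by (rule PiE_UNIV_of_PiE)
    moreover obtain z where "z \<in> ?Z" "fun_add I z x \<in> P" using uB x by blast
    ultimately show "x \<in> (\<Union>z\<in>?Z. B z)" using x by (auto simp: B_def)
  qed (auto simp: B_def)
  have "emeasure ?L P = (\<integral>\<^sup>+z. emeasure ?L (A z) \<partial>count_space ?Z)"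
    unfolding PA
  proof (rule emeasure_UN_countable[OF _ cnt])
    show "disjoint_family_on A ?Z"
      unfolding disjoint_family_on_def
    proof (intro ballI impI)
      fix z w assume "z \<in> ?Z" "w \<in> ?Z" "z \<noteq> w"
      then show "A z \<inter> A w = {}" using uA unfolding A_def by blast
    qed
  qed (use meas P fin in \<open>auto simp: A_def\<close>)
  also have "\<dots> = (\<integral>\<^sup>+z. emeasure ?L (B (\<lambda>i\<in>I. - z i)) \<partial>count_space ?Z)"
    by (intro nn_integral_cong) (simp add: AB)
  also have "\<dots> = (\<integral>\<^sup>+z. emeasure ?L (B z) \<partial>count_space ?Z)"
    by (rule nn_integral_bij_count_space[OF neg])
  also have "\<dots> = emeasure ?L (unit_cube I)"
    unfolding QB
  proof (rule emeasure_UN_countable[OF _ cnt, symmetric])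
    show "disjoint_family_on B ?Z"
      unfolding disjoint_family_on_def
    proof (intro ballI impI)
      fix z w assume "z \<in> ?Z" "w \<in> ?Z" "z \<noteq> w"
      then show "B z \<inter> B w = {}" using uB unfolding B_def by blast
    qed
  qed (use meas P fin in \<open>auto simp: B_def\<close>)
  finally show ?thesis using fin by (simp add: P_def emeasure_unit_cube)
qed

text \<open>Integrating \<open>indicator Q u * indicator A (lin_map I M t + u)\<close> over \<open>t\<close> and \<open>u\<close>, where \<open>Q\<close> is
  the unit cube, in both orders; only translation invariance is needed.\<close>

lemma emeasure_lin_map_vimage:
  assumes fin: "finite I" and MN: "int_inverse I M N" and NM: "int_inverse I N M"
    and A [measurable]: "A \<in> sets (lborel_fun I)"
  shows "emeasure (lborel_fun I) {x \<in> I \<rightarrow>\<^sub>E UNIV. lin_map I M x \<in> A} = emeasure (lborel_fun I) A"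
proof -
  let ?L = "lborel_fun I" and ?Q = "unit_cube I"
  interpret pair_sigma_finite ?L ?L by (rule pair_sigma_finite_lborel_fun[OF fin])
  have [measurable]: "?Q \<in> sets ?L" using fin by simp
  let ?iA = "indicator A :: _ \<Rightarrow> ennreal" and ?iQ = "indicator ?Q :: _ \<Rightarrow> ennreal"
  let ?neg = "\<lambda>i j. - M i j"
  have "emeasure ?L {x \<in> I \<rightarrow>\<^sub>E UNIV. lin_map I M x \<in> A} = (\<integral>\<^sup>+t. ?iA (lin_map I M t) \<partial>?L)"
    by (rule emeasure_vimage_PiE) measurable
  \<comment> \<open>A factor 1 is inserted as the measure of the cube.\<close>
  also have "\<dots> = (\<integral>\<^sup>+u. ?iQ u * (\<integral>\<^sup>+t. ?iA (lin_map I M t) \<partial>?L) \<partial>?L)"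
    using fin by (simp add: nn_integral_multc emeasure_unit_cube)
  \<comment> \<open>For fixed \<open>u\<close>, shifting \<open>t\<close> by
    \<open>lin_map I N u\<close> adds \<open>u\<close> to \<open>lin_map I M t\<close>.\<close>
  also have "\<dots> = (\<integral>\<^sup>+u. ?iQ u * (\<integral>\<^sup>+t. ?iA (fun_add I u (lin_map I M t)) \<partial>?L) \<partial>?L)"
  proof (rule nn_integral_cong)
    fix u assume "u \<in> space ?L"
    then have u: "u \<in> I \<rightarrow>\<^sub>E UNIV" by (simp add: space_lborel_fun)
    have "(\<integral>\<^sup>+t. ?iA (lin_map I M t) \<partial>?L) = (\<integral>\<^sup>+t. ?iA (lin_map I M (fun_add I (lin_map I N u) t)) \<partial>?L)"
      by (rule nn_integral_fun_add[OF fin, symmetric]) measurable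
    then show "?iQ u * (\<integral>\<^sup>+t. ?iA (lin_map I M t) \<partial>?L) = ?iQ u * (\<integral>\<^sup>+t. ?iA (fun_add I u (lin_map I M t)) \<partial>?L)"
      by (simp add: lin_map_fun_add lin_map_inverse[OF fin NM u])
  qed
  also have "\<dots> = (\<integral>\<^sup>+u. (\<integral>\<^sup>+t. ?iQ u * ?iA (fun_add I u (lin_map I M t)) \<partial>?L) \<partial>?L)"
    by (intro nn_integral_cong nn_integral_cmult[symmetric]) measurable
  also have "\<dots> = (\<integral>\<^sup>+t. (\<integral>\<^sup>+u. ?iQ u * ?iA (fun_add I u (lin_map I M t)) \<partial>?L) \<partial>?L)"
    by (rule Fubini') measurable
  \<comment> \<open>For fixed \<open>t\<close>, the substitution
    \<open>w = u + lin_map I M t\<close> moves the dependence on \<open>t\<close> from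
    \<open>A\<close> to the cube.\<close>
  also have "\<dots> = (\<integral>\<^sup>+t. (\<integral>\<^sup>+w. ?iQ (fun_add I (lin_map I ?neg t) w) * ?iA w \<partial>?L) \<partial>?L)"
  proof (rule nn_integral_cong)
    fix t assume [measurable]: "t \<in> space ?L"
    have [measurable]: "(\<lambda>u. ?iQ u * ?iA (fun_add I u (lin_map I M t))) \<in> borel_measurable ?L"
      by measurable
    have "(\<integral>\<^sup>+u. ?iQ u * ?iA (fun_add I u (lin_map I M t)) \<partial>?L) =
      (\<integral>\<^sup>+u. ?iQ (fun_add I (lin_map I ?neg t) u) *
        ?iA (fun_add I (fun_add I (lin_map I ?neg t) u) (lin_map I M t)) \<partial>?L)"
      by (rule nn_integral_fun_add[OF fin, symmetric]) measurable
    also have "\<dots> = (\<integral>\<^sup>+w. ?iQ (fun_add I (lin_map I ?neg t) w) * ?iA w \<partial>?L)"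
    proof (rule nn_integral_cong)
      fix w assume "w \<in> space ?L"
      then have "fun_add I (fun_add I (lin_map I ?neg t) w) (lin_map I M t) = w"
        by (auto simp: lin_map_uminus fun_add_def fun_eq_iff space_lborel_fun PiE_def extensional_def)
      then show "?iQ (fun_add I (lin_map I ?neg t) w) *
          ?iA (fun_add I (fun_add I (lin_map I ?neg t) w) (lin_map I M t)) =
        ?iQ (fun_add I (lin_map I ?neg t) w) * ?iA w" by simp
    qed
    finally show "(\<integral>\<^sup>+u. ?iQ u * ?iA (fun_add I u (lin_map I M t)) \<partial>?L) =
      (\<integral>\<^sup>+w. ?iQ (fun_add I (lin_map I ?neg t) w) * ?iA w \<partial>?L)" .
  qed
  also have "\<dots> = (\<integral>\<^sup>+w. (\<integral>\<^sup>+t. ?iQ (fun_add I (lin_map I ?neg t) w) * ?iA w \<partial>?L) \<partial>?L)"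
    by (rule Fubini') measurable
  also have "\<dots> = (\<integral>\<^sup>+w. ?iA w \<partial>?L)"
  proof (rule nn_integral_cong)
    fix w assume "w \<in> space ?L"
    then have w: "w \<in> I \<rightarrow>\<^sub>E UNIV" by (simp add: space_lborel_fun)
    have neg: "int_inverse I ?neg (\<lambda>i j. - N i j)" "int_inverse I (\<lambda>i j. - N i j) ?neg"
      using MN NM by (auto simp: int_inverse_def)
    have "(\<integral>\<^sup>+t. ?iQ (fun_add I (lin_map I ?neg t) w) * ?iA w \<partial>?L) =
        (\<integral>\<^sup>+t. ?iQ (fun_add I (lin_map I ?neg t) w) \<partial>?L) * ?iA w"
      by (rule nn_integral_multc) (use \<open>w \<in> space ?L\<close> in measurable)
    \<comment> \<open>Shifting \<open>t\<close> by \<open>lin_map I N w\<close> cancels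
      \<open>w\<close>. What remains is the measure of the preimage of the cube under the negative
      of \<open>M\<close>, which is again unimodular.\<close>
    also have "(\<integral>\<^sup>+t. ?iQ (fun_add I (lin_map I ?neg t) w) \<partial>?L) =
        (\<integral>\<^sup>+t. ?iQ (fun_add I (lin_map I ?neg (fun_add I (lin_map I N w) t)) w) \<partial>?L)"
      by (rule nn_integral_fun_add[OF fin, symmetric]) (use \<open>w \<in> space ?L\<close> in measurable)
    also have "\<dots> = (\<integral>\<^sup>+t. ?iQ (lin_map I ?neg t) \<partial>?L)"
    proof (rule nn_integral_cong)
      fix t
      have "fun_add I (lin_map I ?neg (fun_add I (lin_map I N w) t)) w = lin_map I ?neg t"
        unfolding lin_map_fun_add unfolding lin_map_uminus lin_map_inverse[OF fin NM w]
        by (auto simp: fun_add_def lin_map_def fun_eq_iff)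
      then show "?iQ (fun_add I (lin_map I ?neg (fun_add I (lin_map I N w) t)) w) =
          ?iQ (lin_map I ?neg t)" by simp
    qed
    also have "\<dots> = emeasure ?L {x \<in> I \<rightarrow>\<^sub>E UNIV. lin_map I ?neg x \<in> unit_cube I}"
      by (rule emeasure_vimage_PiE[symmetric]) measurable
    also have "\<dots> = 1" by (rule emeasure_lin_map_vimage_unit_cube[OF fin neg])
    finally show "(\<integral>\<^sup>+t. ?iQ (fun_add I (lin_map I ?neg t) w) * ?iA w \<partial>?L) = ?iA w" by simp
  qed
  also have "\<dots> = emeasure ?L A" by simp
  finally show ?thesis .
qed

subsection \<open>The volume in coordinates\<close>

text \<open>\<open>t (2 * i + 1)\<close> and \<open>t (2 * i)\<close> are the flows on the arcs from the source to the \<open>(i + 1)\<close>-st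
  vertex before \<open>n\<close> and from there along the path.  Numbering backwards makes the remaining
  polytope after fixing the first \<open>x\<close> and \<open>y\<close> one of the same kind: \<open>A\<close> is the supply left at the
  source, \<open>y\<close> the inflow along the path, and \<open>k\<close> the number of vertices still to be passed.\<close>

primrec flow_ineqs :: "real \<Rightarrow> nat \<Rightarrow> real \<Rightarrow> real \<Rightarrow> (nat \<Rightarrow> real) \<Rightarrow> bool" where
  "flow_ineqs b 0 A y t \<longleftrightarrow> 0 \<le> A"
| "flow_ineqs b (Suc k) A y t \<longleftrightarrow> 0 \<le> t (2 * k + 1) \<and> 0 \<le> t (2 * k) \<and>
     t (2 * k) \<le> b + t (2 * k + 1) + y \<and> flow_ineqs b k (A - t (2 * k + 1)) (t (2 * k)) t"

text \<open>The factor \<open>A + y + (k + 1) * b\<close> is the total supply of the remaining graph.  At the upper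
  end \<open>y' = b + x + y\<close> of the inner integral it does not depend on \<open>x\<close>, which is why the
  recursion has a product as its solution.\<close>

primrec flow_vol :: "real \<Rightarrow> nat \<Rightarrow> real \<Rightarrow> real \<Rightarrow> real" where
  "flow_vol b 0 A y = 1"
| "flow_vol b (Suc k) A y = A ^ Suc k / (fact (Suc k))\<^sup>2 * (A + y + real (k + 2) * b) ^ k *
     (y + b + A / real (k + 2))"

text \<open>Allows the two coordinates fixed by the outer integrals to be dropped from the inner
  region.\<close>

lemma flow_ineqs_cong:
  "(\<And>i. i < 2 * k \<Longrightarrow> s i = t i) \<Longrightarrow> flow_ineqs b k A y s = flow_ineqs b k A y t"
  by (induction k arbitrary: A y) auto

text \<open>\<open>A\<close> and \<open>y\<close> are functions on the measure space because the
  recursion passes on values that depend on the coordinates.\<close>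

lemma measurable_flow_ineqs:
  assumes "A \<in> borel_measurable M" "y \<in> borel_measurable M"
    "\<And>i. i < 2 * k \<Longrightarrow> (\<lambda>x. t x i) \<in> borel_measurable M"
  shows "Measurable.pred M (\<lambda>x. flow_ineqs b k (A x) (y x) (t x))"
  using assms
proof (induction k arbitrary: A y)
  case 0
  then show ?case by simp
next
  case (Suc k)
  note [measurable] = Suc.prems(1,2)
  have [measurable]: "(\<lambda>x. t x (2 * k)) \<in> borel_measurable M"
    "(\<lambda>x. t x (2 * k + 1)) \<in> borel_measurable M"
    by (auto intro: Suc.prems)
  have [measurable]: "Measurable.pred M
      (\<lambda>x. flow_ineqs b k (A x - t x (2 * k + 1)) (t x (2 * k)) (t x))"
    by (rule Suc.IH) (measurable, auto intro: Suc.prems)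
  show ?case unfolding flow_ineqs.simps by measurable
qed

lemma flow_ineqs_sets [measurable]:
  "{t \<in> {..<2 * k} \<rightarrow>\<^sub>E UNIV. flow_ineqs b k A y t} \<in> sets (lborel_fun {..<2 * k})"
proof -
  have "Measurable.pred (lborel_fun {..<2 * k}) (\<lambda>t. flow_ineqs b k A y t)"
    by (rule measurable_flow_ineqs) auto
  then show ?thesis by (simp add: pred_def space_lborel_fun)
qed

section \<open>Solution of the integral recursion\<close>

lemma flow_vol_nonneg: "0 \<le> A \<Longrightarrow> 0 \<le> y \<Longrightarrow> 0 < b \<Longrightarrow> 0 \<le> flow_vol b k A y"
  by (cases k) auto

text \<open>With \<open>T = A + y + (k + 1) * b\<close>, the derivative of \<open>T ^ k * y\<close>
  in \<open>y\<close> is \<open>T ^ (k - 1) * (T + k * y)\<close> for positive \<open>k\<close>, and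
  \<open>(T + k * y) / (k + 1)\<close> is the last factor \<open>y + b + A / (k + 1)\<close> of
  \<open>flow_vol\<close>.\<close>

lemma flow_vol_integral_height:
  assumes "0 \<le> A" "0 \<le> u" "0 < b"
  shows "(\<integral>\<^sup>+y. ennreal (flow_vol b k A y) * indicator {0..u} y \<partial>lborel) =
    ennreal (A ^ k / (fact k)\<^sup>2 * (A + u + real (k + 1) * b) ^ k * u / real (k + 1))"
proof -
  let ?G = "\<lambda>y. A ^ k / (fact k)\<^sup>2 * (A + y + real (k + 1) * b) ^ k * y / real (k + 1)"
  have "(\<integral>\<^sup>+y. ennreal (flow_vol b k A y) * indicator {0..u} y \<partial>lborel) = ennreal (?G u - ?G 0)"
  proof (rule nn_integral_FTC_Icc)
    show "(\<lambda>y. flow_vol b k A y) \<in> borel_measurable borel" by (cases k) auto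
    fix y assume "y \<in> {0..u}"
    then have y: "0 \<le> y" "y \<le> u" by auto
    show "0 \<le> flow_vol b k A y" using assms y by (intro flow_vol_nonneg)
    show "(?G has_real_derivative flow_vol b k A y) (at y)"
    proof (cases k)
      case 0
      then show ?thesis by simp
    next
      case (Suc j)
      define T where "T = A + y + real (k + 1) * b"
      have dp: "((\<lambda>y. (A + y + r) ^ k) has_real_derivative real k * (A + y + r) ^ j) (at y)" for r
        by (rule DERIV_cong[OF DERIV_power[where D = 1]]) (auto intro!: derivative_eq_intros simp: Suc)
      have d: "((\<lambda>y. C * (A + y + r) ^ k * y / q) has_real_derivative
          C * (real k * (A + y + r) ^ j * y + (A + y + r) ^ k) / q) (at y)" for C q r :: real
        by (rule DERIV_cong[OF DERIV_cdivide[OF DERIV_mult[OF DERIV_cmult[OF dp] DERIV_ident]]])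
          (simp add: algebra_simps)
      have "(?G has_real_derivative
          A ^ k / (fact k)\<^sup>2 * (real k * T ^ j * y + T ^ k) / real (k + 1)) (at y)"
        unfolding T_def by (rule d)
      moreover have "A ^ k / (fact k)\<^sup>2 * (real k * T ^ j * y + T ^ k) / real (k + 1) = flow_vol b k A y"
      proof -
        have "C * (real k * T ^ j * y + T ^ k) / q = C * T ^ j * ((real k * y + T) / q)" for C q :: real
          by (simp add: Suc algebra_simps)
        then have "A ^ k / (fact k)\<^sup>2 * (real k * T ^ j * y + T ^ k) / real (k + 1) =
            A ^ k / (fact k)\<^sup>2 * T ^ j * ((real k * y + T) / real (k + 1))" .
        also have "(real k * y + T) / real (k + 1) = y + b + A / real (k + 1)"
          unfolding T_def by (simp add: field_simps)
        also have "A ^ k / (fact k)\<^sup>2 * T ^ j * (y + b + A / real (k + 1)) = flow_vol b k A y"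
          by (simp add: T_def Suc)
        finally show ?thesis .
      qed
      ultimately show ?thesis by (simp only:)
    qed
  qed (use assms in auto)
  then show ?thesis by simp
qed

text \<open>The power of the total supply is constant in \<open>x\<close>. Writing
  \<open>b + x + y\<close> as \<open>(b + y + A) - (A - x)\<close> leaves only powers of
  \<open>A - x\<close> to integrate.\<close>

lemma flow_vol_integral_source:
  assumes "0 \<le> A" "0 \<le> y" "0 < b"
  shows "(\<integral>\<^sup>+x. ennreal ((A - x) ^ k / (fact k)\<^sup>2 * (A + y + real (k + 2) * b) ^ k * (b + x + y) /
      real (k + 1)) * indicator {0..A} x \<partial>lborel) = ennreal (flow_vol b (Suc k) A y)"
proof -
  define C where "C = (A + y + real (k + 2) * b) ^ k / ((fact k)\<^sup>2 * real (k + 1))"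
  have C: "0 \<le> C" using assms by (simp add: C_def)
  let ?F = "\<lambda>x. C * ((A - x) ^ Suc (Suc k) / real (Suc (Suc k)) - (A - x) ^ Suc k / real (Suc k) * (b + y + A))"
  have "(\<integral>\<^sup>+x. ennreal ((A - x) ^ k / (fact k)\<^sup>2 * (A + y + real (k + 2) * b) ^ k * (b + x + y) /
      real (k + 1)) * indicator {0..A} x \<partial>lborel) =
      (\<integral>\<^sup>+x. ennreal (C * (A - x) ^ k * (b + x + y)) * indicator {0..A} x \<partial>lborel)"
    by (simp add: C_def mult_ac)
  also have "\<dots> = ennreal (?F A - ?F 0)"
  proof (rule nn_integral_FTC_Icc)
    fix x assume "x \<in> {0..A}"
    then have x: "0 \<le> x" "x \<le> A" by auto
    show "0 \<le> C * (A - x) ^ k * (b + x + y)" using assms C x by auto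
    have d: "((\<lambda>x. (A - x) ^ Suc m) has_real_derivative - (real (Suc m) * (A - x) ^ m)) (at x)" for m
      by (rule DERIV_cong[OF DERIV_power[where D = "-1"]]) (auto intro!: derivative_eq_intros)
    have "(?F has_real_derivative C * ((A - x) ^ k * (b + y + A) - (A - x) ^ (k + 1))) (at x)"
      by (rule DERIV_cong[OF DERIV_cmult[OF DERIV_diff[OF DERIV_cdivide[OF d]
              DERIV_cmult_right[OF DERIV_cdivide[OF d]]]]])
        (simp del: of_nat_Suc)
    moreover have "(A - x) ^ k * (b + y + A) - (A - x) ^ (k + 1) = (A - x) ^ k * (b + x + y)"
      by (simp add: algebra_simps)
    ultimately show "(?F has_real_derivative C * (A - x) ^ k * (b + x + y)) (at x)"
      by (simp add: mult.assoc)
  qed (use assms in auto)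
  \<comment> \<open>\<open>?F A\<close> is 0, and \<open>(y + b + A) / (k + 1) - A / (k + 2)\<close>
    equals \<open>(y + b + A / (k + 2)) / (k + 1)\<close>.\<close>
  also have "?F A - ?F 0 = C * A ^ Suc k / real (k + 1) * (y + b + A / real (k + 2))"
    by (simp add: divide_simps) (simp add: algebra_simps)
  also have "\<dots> = flow_vol b (Suc k) A y"
    by (simp add: C_def power2_eq_square mult_ac)
  finally show ?thesis .
qed

text \<open>Negative \<open>A\<close> is included because the recursion continues with
  \<open>A - x\<close> for every \<open>x >= 0\<close>; the region is then empty.\<close>

lemma emeasure_flow_ineqs:
  assumes "0 \<le> y" "0 < b"
  shows "emeasure (lborel_fun {..<2 * k}) {t \<in> {..<2 * k} \<rightarrow>\<^sub>E UNIV. flow_ineqs b k A y t} =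
    (if 0 \<le> A then ennreal (flow_vol b k A y) else 0)"
  using assms(1)
proof (induction k arbitrary: A y)
  case 0
  have "{t \<in> {..<2 * 0} \<rightarrow>\<^sub>E UNIV. flow_ineqs b 0 A y t} = (if 0 \<le> A then {..<0::nat} \<rightarrow>\<^sub>E UNIV else {})"
    by auto
  then show ?case
    using product_sigma_finite.emeasure_PiM[OF product_sigma_finite_lborel, of "{}::nat set" "\<lambda>_. UNIV"]
    by simp
next
  case (Suc k)
  interpret product_sigma_finite "\<lambda>_::nat. lborel :: real measure"
    by (rule product_sigma_finite_lborel)
  let ?I = "{..<2 * k}" and ?J = "insert (2 * k) {..<2 * k}"
  let ?K = "insert (2 * k + 1) ?J"
  let ?S = "\<lambda>k A y. {t \<in> {..<2 * k} \<rightarrow>\<^sub>E UNIV. flow_ineqs b k A y t}"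
  let ?P = "\<lambda>x y'. 0 \<le> x \<and> 0 \<le> y' \<and> y' \<le> b + x + y"
  have K: "{..<2 * Suc k} = ?K" by auto
  have meas: "Measurable.pred M (\<lambda>x. flow_ineqs b (Suc k) A y (t x))"
    if "\<And>i. i \<in> ?K \<Longrightarrow> (\<lambda>x. t x i) \<in> borel_measurable M" for M and t :: "'c \<Rightarrow> nat \<Rightarrow> real"
    by (intro measurable_flow_ineqs) (use that less_Suc_eq in auto)
  have m1: "(\<lambda>t. of_bool (flow_ineqs b (Suc k) A y t) :: ennreal) \<in> borel_measurable (lborel_fun ?K)"
    by (intro measurable_compose[OF meas]) auto
  have m2: "(\<lambda>t. of_bool (flow_ineqs b (Suc k) A y (t(2 * k + 1 := x))) :: ennreal)
      \<in> borel_measurable (lborel_fun ?J)" for x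
    by (intro measurable_compose[OF meas]) auto
  have "emeasure (lborel_fun ?K) (?S (Suc k) A y) =
      (\<integral>\<^sup>+t. indicator (?S (Suc k) A y) t \<partial>lborel_fun ?K)"
    using flow_ineqs_sets[of "Suc k" b A y] unfolding K by simp
  also have "\<dots> = (\<integral>\<^sup>+t. of_bool (flow_ineqs b (Suc k) A y t) \<partial>lborel_fun ?K)"
    unfolding K by (intro nn_integral_cong) (auto simp: space_lborel_fun indicator_def)
  \<comment> \<open>The source flow \<open>x\<close> is split off first and the path flow
    \<open>y'\<close> inside it, since the range of \<open>y'\<close> depends on
    \<open>x\<close>.\<close>
  also have "\<dots> = (\<integral>\<^sup>+x. \<integral>\<^sup>+t. of_bool (flow_ineqs b (Suc k) A y (t(2 * k + 1 := x)))
      \<partial>lborel_fun ?J \<partial>lborel)"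
    by (rule product_nn_integral_insert_rev[OF _ _ m1]) auto
  also have "\<dots> = (\<integral>\<^sup>+x. \<integral>\<^sup>+y'. \<integral>\<^sup>+t.
      of_bool (flow_ineqs b (Suc k) A y (t(2 * k := y', 2 * k + 1 := x)))
      \<partial>lborel_fun ?I \<partial>lborel \<partial>lborel)"
    by (intro nn_integral_cong product_nn_integral_insert_rev[OF _ _ m2]) auto
  also have "\<dots> = (\<integral>\<^sup>+x. \<integral>\<^sup>+y'. of_bool (?P x y') * emeasure (lborel_fun ?I) (?S k (A - x) y')
      \<partial>lborel \<partial>lborel)"
  proof (intro nn_integral_cong)
    fix x y' :: real
    have "flow_ineqs b k (A - x) y' (t(2 * k := y', 2 * k + 1 := x)) = flow_ineqs b k (A - x) y' t" for t
      by (rule flow_ineqs_cong) auto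
    then have "(\<integral>\<^sup>+t. of_bool (flow_ineqs b (Suc k) A y (t(2 * k := y', 2 * k + 1 := x))) \<partial>lborel_fun ?I) =
        (\<integral>\<^sup>+t. of_bool (?P x y') * indicator (?S k (A - x) y') t \<partial>lborel_fun ?I)"
      by (intro nn_integral_cong) (auto simp: space_lborel_fun indicator_def)
    also have "\<dots> = of_bool (?P x y') * emeasure (lborel_fun ?I) (?S k (A - x) y')"
      by (rule nn_integral_cmult_indicator) (rule flow_ineqs_sets)
    finally show "(\<integral>\<^sup>+t. of_bool (flow_ineqs b (Suc k) A y (t(2 * k := y', 2 * k + 1 := x)))
        \<partial>lborel_fun ?I) = \<dots>" .
  qed
  \<comment> \<open>The induction hypothesis gives 0 when \<open>x > A\<close>, which confines
    \<open>x\<close> to \<open>{0..A}\<close>.\<close>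
  also have "\<dots> = (\<integral>\<^sup>+x. \<integral>\<^sup>+y'. indicator {0..A} x *
      (ennreal (flow_vol b k (A - x) y') * indicator {0..b + x + y} y') \<partial>lborel \<partial>lborel)"
    by (intro nn_integral_cong) (auto simp: Suc.IH indicator_def)
  also have "\<dots> = (\<integral>\<^sup>+x. indicator {0..A} x * (\<integral>\<^sup>+y'. 
      (ennreal (flow_vol b k (A - x) y') * indicator {0..b + x + y} y') \<partial>lborel) \<partial>lborel)"
  proof (intro nn_integral_cong nn_integral_cmult)
    fix x
    show "(\<lambda>y'. ennreal (flow_vol b k (A - x) y') * indicator {0..b + x + y} y') \<in> borel_measurable lborel"
      by (cases k) auto
  qed
  also have "\<dots> = (\<integral>\<^sup>+x. ennreal ((A - x) ^ k / (fact k)\<^sup>2 * (A + y + real (k + 2) * b) ^ k * (b + x + y) /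
      real (k + 1)) * indicator {0..A} x \<partial>lborel)"
  proof (rule nn_integral_cong)
    fix x
    have "A - x + (b + x + y) + real (k + 1) * b = A + y + real (k + 2) * b"
      by (simp add: algebra_simps)
    then show "indicator {0..A} x * (\<integral>\<^sup>+y'. 
      (ennreal (flow_vol b k (A - x) y') * indicator {0..b + x + y} y') \<partial>lborel) =
      ennreal ((A - x) ^ k / (fact k)\<^sup>2 * (A + y + real (k + 2) * b) ^ k * (b + x + y) /
      real (k + 1)) * indicator {0..A} x"
      using flow_vol_integral_height[of "A - x" "b + x + y" b k] Suc.prems assms(2)
      by (cases "x \<in> {0..A}") (simp_all only: indicator_simps, auto)
  qed
  also have "\<dots> = (if 0 \<le> A then ennreal (flow_vol b (Suc k) A y) else 0)"
    using flow_vol_integral_source[of A y b k] Suc.prems assms(2) by auto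
  finally show ?case unfolding K .
qed

text \<open>At \<open>y = 0\<close> the last factor of \<open>flow_vol\<close> is the total supply
  divided by \<open>k + 1\<close>, which completes the k-th power;
  \<open>fact (2 * k) / (fact k)^2\<close> is the central binomial coefficient.\<close>

lemma flow_vol_catalan: 
  assumes "0 < A" "0 < b"
  shows "fact (2 * k) * flow_vol b k A 0 =
    1 / (real k + 1) * real ((2 * k) choose k) * A ^ k * (A + (real k + 1) * b) ^ k"
proof (cases k)
  case (Suc j)
  have k: "real (j + 2) = real k + 1" by (simp add: Suc)
  have "b + A / (real k + 1) = (A + (real k + 1) * b) / (real k + 1)"
    by (simp add: field_simps)
  then have "flow_vol b k A 0 =
      A ^ k / (fact k)\<^sup>2 * ((A + (real k + 1) * b) ^ j * ((A + (real k + 1) * b) / (real k + 1)))"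
    unfolding Suc flow_vol.simps k[unfolded Suc] by simp
  also have "\<dots> = A ^ k / (fact k)\<^sup>2 * (A + (real k + 1) * b) ^ k / (real k + 1)"
    by (simp add: Suc)
  finally have "flow_vol b k A 0 = A ^ k / (fact k)\<^sup>2 * (A + (real k + 1) * b) ^ k / (real k + 1)" .
  moreover have "real ((2 * k) choose k) = fact (2 * k) / (fact k)\<^sup>2"
    by (simp add: binomial_fact power2_eq_square mult_2)
  ultimately show ?thesis by (simp add: mult_ac)
qed simp

subsection \<open>Flows on the caracol graph\<close>

text \<open>These arcs carry the free coordinates, in the order in which \<open>flow_ineqs\<close>
  reads them: as \<open>j\<close> runs through the indices below \<open>2 * (n - 2)\<close>,
  \<open>i\<close> goes down from \<open>n - 1\<close> to 2.\<close>

definition coord_arc :: "nat \<Rightarrow> nat \<Rightarrow> nat \<times> nat" where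
  "coord_arc n j = (let i = n - 1 - j div 2 in if odd j then (1, i) else (i, i + 1))"

text \<open>The value \<open>0\<close> below \<open>2\<close> avoids the arc \<open>(1, 2)\<close>, which leaves the source and is not part of
  the path.\<close>

definition path_flow :: "(nat \<times> nat \<Rightarrow> real) \<Rightarrow> nat \<Rightarrow> real" where
  "path_flow x i = (if i < 2 then 0 else x (i, i + 1))"

lemma all_coord_arc_iff:
  "(\<forall>j<2 * (n - 2). P (coord_arc n j)) \<longleftrightarrow> (\<forall>i\<in>{2..<n}. P (1, i) \<and> P (i, i + 1))"
proof (intro iffI ballI allI impI)
  fix i assume H: "\<forall>j<2 * (n - 2). P (coord_arc n j)" and i: "i \<in> {2..<n}"
  have "2 * (n - 1 - i) + 1 < 2 * (n - 2)" "2 * (n - 1 - i) < 2 * (n - 2)"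
    using i by auto
  then have "P (coord_arc n (2 * (n - 1 - i) + 1))" "P (coord_arc n (2 * (n - 1 - i)))"
    using H by blast+
  moreover have "n - 1 - (n - 1 - i) = i" using i by auto
  ultimately show "P (1, i) \<and> P (i, i + 1)" by (simp add: coord_arc_def Let_def)
next
  fix j assume H: "\<forall>i\<in>{2..<n}. P (1, i) \<and> P (i, i + 1)" and j: "j < 2 * (n - 2)"
  have "n - 1 - j div 2 \<in> {2..<n}" using j by auto
  then have "P (1, n - 1 - j div 2) \<and> P (n - 1 - j div 2, n - 1 - j div 2 + 1)" using H by blast
  then show "P (coord_arc n j)" by (simp add: coord_arc_def Let_def)
qed

lemma arcs_caracol:
  "arcs (caracol n) = {(1, j) |j. 2 \<le> j \<and> j \<le> n} \<union> {(i, i + 1) |i. 2 \<le> i \<and> i \<le> n}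
    \<union> {(i, n + 1) |i. 2 \<le> i \<and> i + 1 \<le> n}"
  by (simp add: caracol_def)

lemma ball_arcs_caracol_iff:
  assumes "n \<ge> 2"
  shows "(\<forall>e\<in>arcs (caracol n). P e) \<longleftrightarrow>
    (\<forall>i\<in>{2..<n}. P (1, i) \<and> P (i, i + 1) \<and> P (i, n + 1)) \<and> P (1, n) \<and> P (n, n + 1)"
proof -
  have "(\<forall>e\<in>arcs (caracol n). P e) \<longleftrightarrow>
      (\<forall>i\<in>{2..n}. P (1, i)) \<and> (\<forall>i\<in>{2..n}. P (i, i + 1)) \<and> (\<forall>i\<in>{2..<n}. P (i, n + 1))"
    unfolding arcs_caracol by fastforce
  moreover have "{2..n} = insert n {2..<n}" using assms by auto
  ultimately show ?thesis by (simp only: ball_simps) blast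
qed

lemma coord_arc_in_arcs: "j < 2 * (n - 2) \<Longrightarrow> coord_arc n j \<in> arcs (caracol n)"
  using all_coord_arc_iff[of n "\<lambda>e. e \<in> arcs (caracol n)"] by (auto simp: arcs_caracol)

section \<open>Flow conservation and free coordinates\<close>

lemma netflow_caracol_1: "netflow (caracol n) x 1 = (\<Sum>j\<in>{2..n}. x (1, j))"
proof -
  have "out_arcs (caracol n) 1 = Pair 1 ` {2..n}" "in_arcs (caracol n) 1 = {}"
    by (auto simp: out_arcs_def in_arcs_def caracol_def)
  then show ?thesis by (simp add: netflow_def sum.reindex inj_on_def)
qed

lemma in_flow_caracol:
  assumes "i \<in> {2..n}"
  shows "(\<Sum>e\<in>in_arcs (caracol n) i. x e) = x (1, i) + path_flow x (i - 1)"
proof -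
  have "in_arcs (caracol n) i = (if i = 2 then {(1, i)} else {(1, i), (i - 1, i)})"
    using assms by (auto simp: in_arcs_def caracol_def)
  then show ?thesis using assms by (auto simp: path_flow_def)
qed

lemma netflow_caracol_inner:
  assumes "i \<in> {2..<n}"
  shows "netflow (caracol n) x i = x (i, i + 1) + x (i, n + 1) - (x (1, i) + path_flow x (i - 1))"
proof -
  have "out_arcs (caracol n) i = {(i, i + 1), (i, n + 1)}"
    using assms by (auto simp: out_arcs_def caracol_def)
  then show ?thesis using assms in_flow_caracol[of i n x] by (simp add: netflow_def)
qed

lemma netflow_caracol_last:
  assumes "n \<ge> 2"
  shows "netflow (caracol n) x n = x (n, n + 1) - (x (1, n) + path_flow x (n - 1))"
proof -
  have "out_arcs (caracol n) n = {(n, n + 1)}"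
    using assms by (auto simp: out_arcs_def caracol_def)
  then show ?thesis using assms in_flow_caracol[of n n x] by (simp add: netflow_def)
qed

text \<open>The conservation equations are solved for the flows on \<open>(1, n)\<close>,
  \<open>(i, n + 1)\<close> and \<open>(n, n + 1)\<close>, one per vertex. The system is triangular
  with unit coefficients, so the remaining flows are free and integrality is preserved.\<close>

lemma flow_space_caracol_iff:
  assumes "n \<ge> 2"
  shows "x \<in> flow_space n (caracol n) (\<lambda>j. if j = 1 then a else b) \<longleftrightarrow>
    x \<in> extensional (arcs (caracol n)) \<and> x (1, n) = of_int a - (\<Sum>i\<in>{2..<n}. x (1, i)) \<and>
    (\<forall>i\<in>{2..<n}. x (i, n + 1) = of_int b + x (1, i) + path_flow x (i - 1) - x (i, i + 1)) \<and>
    x (n, n + 1) = of_int b + x (1, n) + path_flow x (n - 1)"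
proof -
  have v: "{1..n} = insert 1 (insert n {2..<n})" and w: "{2..n} = insert n {2..<n}"
    using assms by auto
  show ?thesis
    using assms
    unfolding flow_space_def v
    by (auto simp: netflow_caracol_1[unfolded One_nat_def] netflow_caracol_inner netflow_caracol_last
        w PiE_def algebra_simps)
qed

lemma flow_eqI:
  assumes "n \<ge> 2" "x \<in> flow_space n (caracol n) (\<lambda>j. if j = 1 then a else b)"
    "y \<in> flow_space n (caracol n) (\<lambda>j. if j = 1 then a else b)"
    "\<And>j. j < 2 * (n - 2) \<Longrightarrow> x (coord_arc n j) = y (coord_arc n j)"
  shows "x = y"
proof -
  note x = assms(2)[unfolded flow_space_caracol_iff[OF assms(1)]]
    and y = assms(3)[unfolded flow_space_caracol_iff[OF assms(1)]]
  have c: "x (1, i) = y (1, i)" "x (i, i + 1) = y (i, i + 1)" if "i \<in> {2..<n}" for i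
    using assms(4) all_coord_arc_iff[of n "\<lambda>e. x e = y e"] that by auto
  have p: "path_flow x (i - 1) = path_flow y (i - 1)" if "i \<le> n" for i
    using c(2)[of "i - 1"] that by (auto simp: path_flow_def)
  have n1: "x (1, n) = y (1, n)" using x y c(1) by (metis (no_types, lifting) sum.cong)
  have "x (n, n + 1) = y (n, n + 1)" using x y n1 p[of n] by simp
  moreover have "x (i, n + 1) = y (i, n + 1)" if "i \<in> {2..<n}" for i
    using x y c[OF that] p[of i] that by simp
  ultimately have "\<forall>e\<in>arcs (caracol n). x e = y e"
    unfolding ball_arcs_caracol_iff[OF assms(1)] using c n1 by blast
  then show ?thesis using x y by (auto intro: extensionalityI)
qed

lemma ex_flow_with_coords:
  fixes t :: "nat \<Rightarrow> real" and a b :: int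
  assumes "n \<ge> 2"
  obtains x where "x \<in> flow_space n (caracol n) (\<lambda>j. if j = 1 then a else b)"
    "\<And>j. j < 2 * (n - 2) \<Longrightarrow> x (coord_arc n j) = t j"
    "(\<And>j. t j \<in> \<int>) \<Longrightarrow> \<forall>e\<in>arcs (caracol n). x e \<in> \<int>"
proof -
  \<comment> \<open>\<open>X i\<close> and \<open>Y i\<close> are the intended flows on
    \<open>(1, i)\<close> and \<open>(i, i + 1)\<close>. \<open>X n\<close> is the supply left at
    the source, and \<open>Y\<close> vanishes below 2 to agree with
    \<open>path_flow\<close>.\<close>
  define X where "X i = (if i < n then t (2 * (n - 1 - i) + 1)
    else of_int a - (\<Sum>i\<in>{2..<n}. t (2 * (n - 1 - i) + 1)))" for i
  define Y where "Y i = (if i < 2 then 0 else t (2 * (n - 1 - i)))" for i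
  \<comment> \<open>The order of the cases matters: \<open>(1, 2)\<close> and
    \<open>(n, n + 1)\<close> also have the form \<open>(i, i + 1)\<close> but do not carry a path
    coordinate.\<close>
  define x where "x = (\<lambda>e\<in>arcs (caracol n). if fst e = 1 then X (snd e)
    else if e = (n, n + 1) then of_int b + X n + Y (n - 1)
    else if snd e = fst e + 1 then Y (fst e)
    else of_int b + X (fst e) + Y (fst e - 1) - Y (fst e))"
  have arcs: "(1, i) \<in> arcs (caracol n)" "(i, i + 1) \<in> arcs (caracol n)" if "i \<in> {2..n}" for i
    using that by (auto simp: arcs_caracol)
  have arcs': "(i, n + 1) \<in> arcs (caracol n)" if "i \<in> {2..<n}" for i
    using that by (auto simp: arcs_caracol)
  have x1: "x (1, i) = X i" if "i \<in> {2..n}" for i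
    using arcs(1)[OF that] by (simp add: x_def)
  have xy: "x (i, i + 1) = Y i" if "i \<in> {2..<n}" for i
    using arcs(2)[of i] that by (simp add: x_def)
  have xz: "x (i, n + 1) = of_int b + X i + Y (i - 1) - Y i" if "i \<in> {2..<n}" for i
    using arcs'[of i] that by (simp add: x_def)
  have xn: "x (n, n + 1) = of_int b + X n + Y (n - 1)"
    using arcs(2)[of n] assms by (simp add: x_def)
  have p: "path_flow x (i - 1) = Y (i - 1)" if "i \<le> n" for i
    using xy[of "i - 1"] that by (auto simp: path_flow_def Y_def)
  have Xn: "X n = of_int a - (\<Sum>i\<in>{2..<n}. X i)" by (simp add: X_def)
  show thesis
  proof
    have "(\<Sum>i\<in>{2..<n}. x (1, i)) = (\<Sum>i\<in>{2..<n}. X i)" by (intro sum.cong refl x1) auto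
    moreover have "x (1, n) = X n" using x1[of n] assms by simp
    moreover have "x (i, n + 1) = of_int b + x (1, i) + path_flow x (i - 1) - x (i, i + 1)"
      if "i \<in> {2..<n}" for i
      using xz[OF that] x1[of i] xy[OF that] p[of i] that by simp
    moreover have "x \<in> extensional (arcs (caracol n))" by (simp add: x_def)
    ultimately show "x \<in> flow_space n (caracol n) (\<lambda>j. if j = 1 then a else b)"
      unfolding flow_space_caracol_iff[OF assms] using xn Xn p[of n] by simp
    show "x (coord_arc n j) = t j" if j: "j < 2 * (n - 2)" for j
    proof -
      have i: "n - 1 - j div 2 \<in> {2..<n}" "n - 1 - (n - 1 - j div 2) = j div 2"
        using j by auto
      show ?thesis
        using x1[of "n - 1 - j div 2"] xy[OF i(1)] i
        by (auto simp: coord_arc_def Let_def X_def Y_def)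
    qed
    assume t: "\<And>j. t j \<in> \<int>"
    have "X i \<in> \<int>" "Y i \<in> \<int>" for i
      using t by (auto simp: X_def Y_def intro!: Ints_diff Ints_sum)
    then show "\<forall>e\<in>arcs (caracol n). x e \<in> \<int>"
      by (auto simp: x_def intro!: Ints_diff Ints_add)
  qed
qed

text \<open>The slack in each upper bound of \<open>flow_ineqs\<close> is the flow on
  \<open>(i, n + 1)\<close>, and the supply left at the end is the flow on
  \<open>(1, n)\<close>.\<close>

lemma nonneg_flow_iff_flow_ineqs:
  assumes "n \<ge> 2" "b > 0"
    and x: "x \<in> flow_space n (caracol n) (\<lambda>j. if j = 1 then a else b)"
  shows "(\<forall>e\<in>arcs (caracol n). 0 \<le> x e) \<longleftrightarrow>
    flow_ineqs (of_int b) (n - 2) (of_int a) 0 (\<lambda>j. x (coord_arc n j))"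
proof -
  note x = x[unfolded flow_space_caracol_iff[OF assms(1)]]
  let ?c = "\<lambda>j. x (coord_arc n j)"
  \<comment> \<open>Induction from the last vertices backwards: the supply argument is what the
    source still has for the vertices from \<open>n - k\<close> on, the height argument the inflow
    along the path into \<open>n - k\<close>.\<close>
  have "flow_ineqs (of_int b) k (of_int a - (\<Sum>i\<in>{2..<n - k}. x (1, i))) (path_flow x (n - k - 1)) ?c \<longleftrightarrow>
      0 \<le> x (1, n) \<and> (\<forall>i\<in>{n - k..<n}. 0 \<le> x (1, i) \<and> 0 \<le> x (i, i + 1) \<and> 0 \<le> x (i, n + 1))"
    if "k \<le> n - 2" for k
    using that
  proof (induction k)
    case 0
    then show ?case using x by simp
  next
    case (Suc k)
    define i where "i = n - Suc k"
    have i: "2 \<le> i" "i < n" "n - k = Suc i" using Suc.prems by (auto simp: i_def)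
    have c: "?c (2 * k + 1) = x (1, i)" "?c (2 * k) = x (i, i + 1)"
      by (simp_all add: coord_arc_def Let_def i_def)
    have s: "{2..<Suc i} = insert i {2..<i}" "{i..<n} = insert i {Suc i..<n}" using i by auto
    let ?nonneg = "\<lambda>i. 0 \<le> x (1, i) \<and> 0 \<le> x (i, i + 1) \<and> 0 \<le> x (i, n + 1)"
    have "of_int a - (\<Sum>i\<in>{2..<n - k}. x (1, i)) = of_int a - (\<Sum>i\<in>{2..<i}. x (1, i)) - x (1, i)"
      unfolding i(3) s(1) by simp
    moreover have "path_flow x (n - k - 1) = x (i, i + 1)" using i by (simp add: path_flow_def)
    moreover have "flow_ineqs (of_int b) k (of_int a - (\<Sum>i\<in>{2..<n - k}. x (1, i)))
        (path_flow x (n - k - 1)) ?c \<longleftrightarrow> 0 \<le> x (1, n) \<and> (\<forall>i\<in>{Suc i..<n}. ?nonneg i)"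
      using Suc unfolding i(3) by simp
    ultimately have "flow_ineqs (of_int b) (Suc k) (of_int a - (\<Sum>i\<in>{2..<i}. x (1, i)))
        (path_flow x (i - 1)) ?c \<longleftrightarrow> 0 \<le> x (1, i) \<and> 0 \<le> x (i, i + 1) \<and>
          x (i, i + 1) \<le> of_int b + x (1, i) + path_flow x (i - 1) \<and>
          0 \<le> x (1, n) \<and> (\<forall>i\<in>{Suc i..<n}. ?nonneg i)"
      unfolding flow_ineqs.simps c by (simp only:)
    also have "x (i, i + 1) \<le> of_int b + x (1, i) + path_flow x (i - 1) \<longleftrightarrow> 0 \<le> x (i, n + 1)"
      using x i by auto
    also have "0 \<le> x (1, i) \<and> 0 \<le> x (i, i + 1) \<and> 0 \<le> x (i, n + 1) \<and>
          0 \<le> x (1, n) \<and> (\<forall>i\<in>{Suc i..<n}. ?nonneg i) \<longleftrightarrow>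
        0 \<le> x (1, n) \<and> (\<forall>i\<in>{i..<n}. ?nonneg i)"
      unfolding s(2) by (simp only: ball_simps) blast
    finally show ?case unfolding i_def .
  qed
  from this[of "n - 2"] have "flow_ineqs (of_int b) (n - 2) (of_int a) 0 ?c \<longleftrightarrow>
      0 \<le> x (1, n) \<and> (\<forall>i\<in>{2..<n}. 0 \<le> x (1, i) \<and> 0 \<le> x (i, i + 1) \<and> 0 \<le> x (i, n + 1))"
    using assms(1) by (simp add: path_flow_def)
  \<comment> \<open>The last arc carries \<open>b\<close> plus everything that enters
    \<open>n\<close>, so its nonnegativity follows.\<close>
  moreover have "0 \<le> x (n, n + 1)"
    if "0 \<le> x (1, n)" "\<forall>i\<in>{2..<n}. 0 \<le> x (1, i) \<and> 0 \<le> x (i, i + 1) \<and> 0 \<le> x (i, n + 1)"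
  proof -
    have "0 \<le> path_flow x (n - 1)"
      using bspec[OF that(2), of "n - 1"] by (auto simp: path_flow_def)
    then show ?thesis using x that(1) assms(2) by simp
  qed
  ultimately show ?thesis unfolding ball_arcs_caracol_iff[OF assms(1)] by blast
qed

section \<open>Linear combinations of flows and bases of the flow lattice\<close>

lemma netflow_add_lin_comb:
  "netflow G (\<lambda>e\<in>arcs G. p e + lin_comb (arcs G) d v t e) j =
    netflow G p j + (\<Sum>k<d. t k * netflow G (v k) j)"
proof -
  have s: "(\<Sum>e\<in>A. (\<lambda>e\<in>arcs G. p e + lin_comb (arcs G) d v t e) e) =
      (\<Sum>e\<in>A. p e) + (\<Sum>k<d. t k * (\<Sum>e\<in>A. v k e))" if "A \<subseteq> arcs G" for A
  proof -
    have "(\<Sum>e\<in>A. (\<lambda>e\<in>arcs G. p e + lin_comb (arcs G) d v t e) e) =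
        (\<Sum>e\<in>A. p e + (\<Sum>k<d. t k * v k e))"
      using that by (intro sum.cong) (auto simp: lin_comb_def)
    then show ?thesis by (simp add: sum.distrib sum_distrib_left sum.swap[of _ A])
  qed
  show ?thesis
    unfolding netflow_def
    by (subst (1 2) s) (auto simp: out_arcs_def in_arcs_def sum_subtractf right_diff_distrib)
qed

lemma flow_space_add_lin_comb:
  assumes "p \<in> flow_space n G a" "\<And>k. k < d \<Longrightarrow> v k \<in> flow_space n G (\<lambda>_. 0)"
  shows "(\<lambda>e\<in>arcs G. p e + lin_comb (arcs G) d v t e) \<in> flow_space n G a"
  using assms unfolding flow_space_def mem_Collect_eq netflow_add_lin_comb by auto

lemma flow_space_lin_comb:
  assumes "\<And>k. k < d \<Longrightarrow> v k \<in> flow_space n G (\<lambda>_. 0)"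
  shows "lin_comb (arcs G) d v t \<in> flow_space n G (\<lambda>_. 0)"
proof -
  have "lin_comb (arcs G) d v t =
      (\<lambda>e\<in>arcs G. (\<lambda>e\<in>arcs G. 0) e + lin_comb (arcs G) d v t e)"
    by (auto simp: lin_comb_def)
  moreover have "(\<lambda>e\<in>arcs G. 0) \<in> flow_space n G (\<lambda>_. 0)"
    by (auto simp: flow_space_def netflow_def out_arcs_def in_arcs_def)
  ultimately show ?thesis using flow_space_add_lin_comb[of _ n G "\<lambda>_. 0" d v t] assms by metis
qed

lemma lin_comb_coord_arc:
  assumes "j < 2 * (n - 2)"
  shows "lin_comb (arcs (caracol n)) d v t (coord_arc n j) = (\<Sum>k<d. t k * v k (coord_arc n j))"
  using coord_arc_in_arcs[OF assms] by (simp add: lin_comb_def)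

lemma lin_comb_unit:
  assumes "k < d" "v k \<in> extensional E"
  shows "lin_comb E d v (\<lambda>l\<in>{..<d}. if l = k then 1 else 0) = v k"
proof
  fix e
  have "(\<Sum>l<d. (\<lambda>l\<in>{..<d}. if l = k then 1 else 0) l * v l e) = (\<Sum>l<d. if l = k then v l e else 0)"
    by (intro sum.cong) auto
  then show "lin_comb E d v (\<lambda>l\<in>{..<d}. if l = k then 1 else 0) e = v k e"
    using assms by (auto simp: lin_comb_def extensional_def)
qed

lemma unit_flows:
  assumes "n \<ge> 2"
  obtains w where "\<And>k. w k \<in> flow_lattice n (caracol n)"
    "\<And>k j. j < 2 * (n - 2) \<Longrightarrow> w k (coord_arc n j) = (if j = k then 1 else 0)"
proof -
  have "\<exists>x. x \<in> flow_lattice n (caracol n) \<and>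
      (\<forall>j<2 * (n - 2). x (coord_arc n j) = (if j = k then 1 else 0))" for k
    by (rule ex_flow_with_coords[OF assms, of 0 0 "\<lambda>j. if j = k then 1 else 0"])
      (auto simp: flow_lattice_def)
  then show ?thesis using that by metis
qed

lemma flow_lattice_eqI:
  assumes "n \<ge> 2" "x \<in> flow_space n (caracol n) (\<lambda>_. 0)" "y \<in> flow_space n (caracol n) (\<lambda>_. 0)"
    "\<And>j. j < 2 * (n - 2) \<Longrightarrow> x (coord_arc n j) = y (coord_arc n j)"
  shows "x = y"
  using flow_eqI[of n x 0 0 y] assms by simp

text \<open>Guarantees that the basis chosen in \<open>normalized_volume\<close> really is one. The
  unit flows work because the coefficients of a lattice point are its free coordinates.\<close>

lemma ex_lattice_basis_caracol:
  assumes "n \<ge> 2"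
  shows "\<exists>v. lattice_basis (arcs (caracol n)) (2 * (n - 2)) (flow_lattice n (caracol n)) v"
proof -
  obtain w where w: "\<And>k. w k \<in> flow_lattice n (caracol n)"
    "\<And>k j. j < 2 * (n - 2) \<Longrightarrow> w k (coord_arc n j) = (if j = k then 1 else 0)"
    using unit_flows[OF assms] by blast
  let ?E = "arcs (caracol n)" and ?d = "2 * (n - 2)"
  have coord: "lin_comb ?E ?d w c (coord_arc n j) = c j" if "j < ?d" for c j
    using that by (simp add: lin_comb_coord_arc w if_distrib cong: if_cong)
  have ex1: "\<exists>!c. c \<in> {..<?d} \<rightarrow>\<^sub>E \<int> \<and> x = lin_comb ?E ?d w c" if x: "x \<in> flow_lattice n (caracol n)" for x
  proof (rule ex1I)
    let ?c = "\<lambda>j\<in>{..<?d}. x (coord_arc n j)"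
    have "x = lin_comb ?E ?d w ?c"
      by (rule flow_lattice_eqI[OF assms])
        (use x w(1) coord in \<open>auto simp: flow_lattice_def intro!: flow_space_lin_comb\<close>)
    moreover have "?c \<in> {..<?d} \<rightarrow>\<^sub>E \<int>"
      using x coord_arc_in_arcs by (auto simp: flow_lattice_def)
    ultimately show "?c \<in> {..<?d} \<rightarrow>\<^sub>E \<int> \<and> x = lin_comb ?E ?d w ?c" by blast
  next
    fix c assume c: "c \<in> {..<?d} \<rightarrow>\<^sub>E \<int> \<and> x = lin_comb ?E ?d w c"
    then have "x (coord_arc n j) = c j" if "j < ?d" for j using coord[OF that] by simp
    then show "c = (\<lambda>j\<in>{..<?d}. x (coord_arc n j))"
      using c by (auto simp: PiE_def extensional_def)
  qed
  show ?thesis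
    unfolding lattice_basis_def by (intro exI[of _ w] conjI allI impI ballI w(1) ex1)
qed

text \<open>The rows of \<open>N\<close> are the coefficients of the unit flows in the basis
  \<open>v\<close>. Reading off coordinates shows that \<open>N\<close> times the coordinate matrix
  is the identity; the opposite product follows from uniqueness of the coefficients of
  \<open>v k\<close>.\<close>

lemma lattice_basis_unimodular:
  assumes "n \<ge> 2"
    and v: "lattice_basis (arcs (caracol n)) (2 * (n - 2)) (flow_lattice n (caracol n)) v"
  obtains N where "int_inverse {..<2 * (n - 2)} (\<lambda>k j. v k (coord_arc n j)) N"
    "int_inverse {..<2 * (n - 2)} N (\<lambda>k j. v k (coord_arc n j))"
proof -
  let ?E = "arcs (caracol n)" and ?d = "2 * (n - 2)" and ?L = "flow_lattice n (caracol n)"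
  let ?M = "\<lambda>k j. v k (coord_arc n j)"
  obtain w where w: "\<And>k. w k \<in> ?L"
    "\<And>k j. j < ?d \<Longrightarrow> w k (coord_arc n j) = (if j = k then 1 else 0)"
    using unit_flows[OF assms(1)] by blast
  have vL: "v k \<in> ?L" if "k < ?d" for k using v that by (auto simp: lattice_basis_def)
  have uniq: "c = c'" if "c \<in> {..<?d} \<rightarrow>\<^sub>E \<int>" "c' \<in> {..<?d} \<rightarrow>\<^sub>E \<int>"
    "lin_comb ?E ?d v c \<in> ?L" "lin_comb ?E ?d v c = lin_comb ?E ?d v c'" for c c'
    using v that unfolding lattice_basis_def by metis
  have "\<exists>c. c \<in> {..<?d} \<rightarrow>\<^sub>E \<int> \<and> w j = lin_comb ?E ?d v c" for j
    using v w(1) unfolding lattice_basis_def by blast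
  then obtain N where N: "\<And>j. N j \<in> {..<?d} \<rightarrow>\<^sub>E \<int>" "\<And>j. w j = lin_comb ?E ?d v (N j)"
    by metis
  have NZ: "N i j \<in> \<int>" if "j < ?d" for i j using N(1)[of i] that by auto
  have MZ: "?M i j \<in> \<int>" if "i < ?d" "j < ?d" for i j
    using vL[OF that(1)] coord_arc_in_arcs[OF that(2)] by (auto simp: flow_lattice_def)
  have NM: "(\<Sum>k<?d. N i k * ?M k j) = (if i = j then 1 else 0)" if "j < ?d" for i j
    using w(2)[OF that, of i] that unfolding N(2) by (auto simp: lin_comb_coord_arc)
  have MN: "(\<Sum>j<?d. ?M k j * N j l) = (if k = l then 1 else 0)" if k: "k < ?d" and l: "l < ?d" for k l
  proof -
    let ?c = "\<lambda>l\<in>{..<?d}. \<Sum>j<?d. ?M k j * N j l"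
    have "lin_comb ?E ?d v ?c = v k"
    proof (rule flow_lattice_eqI[OF assms(1)])
      show "lin_comb ?E ?d v ?c \<in> flow_space n (caracol n) (\<lambda>_. 0)"
        using vL by (intro flow_space_lin_comb) (auto simp: flow_lattice_def)
      show "v k \<in> flow_space n (caracol n) (\<lambda>_. 0)" using vL[OF k] by (auto simp: flow_lattice_def)
      fix m assume m: "m < ?d"
      have "lin_comb ?E ?d v ?c (coord_arc n m) = (\<Sum>l<?d. (\<Sum>j<?d. ?M k j * N j l) * ?M l m)"
        by (simp add: lin_comb_coord_arc[OF m])
      also have "\<dots> = (\<Sum>j<?d. ?M k j * (\<Sum>l<?d. N j l * ?M l m))"
        unfolding sum_distrib_left sum_distrib_right by (subst sum.swap) (simp add: mult.assoc)
      also have "\<dots> = ?M k m"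
        using m by (simp add: NM if_distrib cong: if_cong)
      finally show "lin_comb ?E ?d v ?c (coord_arc n m) = v k (coord_arc n m)" .
    qed
    moreover have "lin_comb ?E ?d v (\<lambda>l\<in>{..<?d}. if l = k then 1 else 0) = v k"
      using vL[OF k] by (intro lin_comb_unit k) (auto simp: flow_lattice_def flow_space_def PiE_def)
    moreover have "?c \<in> {..<?d} \<rightarrow>\<^sub>E \<int>" using MZ NZ k by (auto intro!: Ints_sum Ints_mult)
    ultimately have "?c = (\<lambda>l\<in>{..<?d}. if l = k then 1 else 0)"
      using vL[OF k] by (intro uniq) auto
    then show ?thesis using l by (auto dest: fun_cong[of _ _ l])
  qed
  show thesis
    by (rule that[of N]) (auto simp: int_inverse_def NZ MZ NM MN)
qed

section \<open>The volume formula\<close>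

lemma flow_ineqs_zero: "0 \<le> a \<Longrightarrow> 0 \<le> b \<Longrightarrow> flow_ineqs b k a 0 (\<lambda>_. 0)"
  by (induction k) auto

theorem theorem6p15:
  fixes n :: nat and a b :: int
  assumes "n \<ge> 2" and "a > 0" and "b > 0"
  shows "flow_polytope_volume n (caracol n) (\<lambda>j. if j = 1 then a else b) =
    catalan (n - 2) * of_int a ^ (n - 2) * (of_int a + (real n - 1) * of_int b) ^ (n - 2)"
proof -
  let ?E = "arcs (caracol n)" and ?d = "2 * (n - 2)" and ?a = "\<lambda>j. if j = 1 then a else b"
  let ?P = "flow_polytope n (caracol n) ?a" and ?I = "{..<2 * (n - 2)}"
  define v where "v = (SOME v. lattice_basis ?E ?d (flow_lattice n (caracol n)) v)"
  define p where "p = (SOME p. p \<in> ?P)"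
  have v: "lattice_basis ?E ?d (flow_lattice n (caracol n)) v"
    unfolding v_def by (rule someI_ex[OF ex_lattice_basis_caracol[OF assms(1)]])
  have P_iff: "x \<in> ?P \<longleftrightarrow> flow_ineqs (of_int b) (n - 2) (of_int a) 0 (\<lambda>j. x (coord_arc n j))"
    if "x \<in> flow_space n (caracol n) ?a" for x
    using nonneg_flow_iff_flow_ineqs[OF assms(1,3) that] that by (simp add: flow_polytope_def)
  \<comment> \<open>The polytope is nonempty, so the chosen base point \<open>p\<close> lies in it:
    in \<open>q\<close> the source sends everything along \<open>(1, n)\<close> and each inner
    vertex sends its supply \<open>b\<close> straight to the sink.\<close>
  obtain q where q: "q \<in> flow_space n (caracol n) ?a" "\<And>j. j < ?d \<Longrightarrow> q (coord_arc n j) = 0"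
    by (rule ex_flow_with_coords[OF assms(1), of a b "\<lambda>_. 0"]) blast
  have "flow_ineqs (of_int b) (n - 2) (of_int a) 0 (\<lambda>j. q (coord_arc n j)) \<longleftrightarrow>
      flow_ineqs (of_int b) (n - 2) (of_int a) 0 (\<lambda>_. 0)"
    by (rule flow_ineqs_cong) (rule q(2))
  then have "q \<in> ?P" using P_iff[OF q(1)] flow_ineqs_zero assms(2,3) by simp
  then have "p \<in> ?P" unfolding p_def by (rule someI[of "\<lambda>p. p \<in> ?P"])
  then have p: "p \<in> flow_space n (caracol n) ?a" by (simp add: flow_polytope_def)
  have v0: "v k \<in> flow_space n (caracol n) (\<lambda>_. 0)" if "k < ?d" for k
    using v that by (auto simp: lattice_basis_def flow_lattice_def)
  define M where "M = (\<lambda>k j. v k (coord_arc n j))"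
  obtain N where MN: "int_inverse ?I M N" "int_inverse ?I N M"
    using lattice_basis_unimodular[OF assms(1) v] unfolding M_def by blast
  define c where "c = (\<lambda>j. p (coord_arc n j))"
  define R where "R = {t \<in> ?I \<rightarrow>\<^sub>E UNIV. flow_ineqs (of_int b) (n - 2) (of_int a) 0 t}"
  have R: "R \<in> sets (lborel_fun ?I)" unfolding R_def by (rule flow_ineqs_sets)
  define R' where "R' = {t \<in> ?I \<rightarrow>\<^sub>E UNIV. fun_add ?I c t \<in> R}"
  have R': "R' \<in> sets (lborel_fun ?I)"
  proof -
    have "R' = fun_add ?I c -` R \<inter> space (lborel_fun ?I)" by (auto simp: R'_def space_lborel_fun)
    then show ?thesis using measurable_sets[OF measurable_fun_add_const R] by simp
  qed
  \<comment> \<open>The flow with parameter \<open>t\<close> has coordinate vector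
    \<open>c + lin_map ?I M t\<close>. Hence the measured set is the preimage of \<open>R\<close>
    under a unimodular map followed by a translation, and neither changes the measure.\<close>
  have "(\<lambda>e\<in>?E. p e + lin_comb ?E ?d v t e) \<in> ?P \<longleftrightarrow> lin_map ?I M t \<in> R'" for t
  proof -
    let ?x = "\<lambda>e\<in>?E. p e + lin_comb ?E ?d v t e"
    have "?x (coord_arc n j) = fun_add ?I c (lin_map ?I M t) j" if "j < ?d" for j
      using that coord_arc_in_arcs[OF that]
      by (simp add: fun_add_def lin_map_def c_def M_def lin_comb_coord_arc)
    then have "flow_ineqs (of_int b) (n - 2) (of_int a) 0 (\<lambda>j. ?x (coord_arc n j)) \<longleftrightarrow>
        flow_ineqs (of_int b) (n - 2) (of_int a) 0 (fun_add ?I c (lin_map ?I M t))"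
      by (rule flow_ineqs_cong)
    moreover have "?x \<in> flow_space n (caracol n) ?a"
      by (rule flow_space_add_lin_comb[OF p v0])
    ultimately show ?thesis using P_iff[of ?x] by (simp add: R'_def R_def)
  qed
  then have "emeasure (lborel_fun ?I) {t \<in> ?I \<rightarrow>\<^sub>E UNIV. (\<lambda>e\<in>?E. p e + lin_comb ?E ?d v t e) \<in> ?P} =
      emeasure (lborel_fun ?I) {t \<in> ?I \<rightarrow>\<^sub>E UNIV. lin_map ?I M t \<in> R'}"
    by simp
  also have "\<dots> = emeasure (lborel_fun ?I) R'"
    by (rule emeasure_lin_map_vimage[OF _ MN R']) simp
  also have "\<dots> = emeasure (lborel_fun ?I) R"
    unfolding R'_def by (rule emeasure_fun_add_vimage[OF _ R]) simp
  also have "\<dots> = ennreal (flow_vol (of_int b) (n - 2) (of_int a) 0)"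
    unfolding R_def using assms by (subst emeasure_flow_ineqs) auto
  finally have "measure (lborel_fun ?I) {t \<in> ?I \<rightarrow>\<^sub>E UNIV. (\<lambda>e\<in>?E. p e + lin_comb ?E ?d v t e) \<in> ?P} =
      flow_vol (of_int b) (n - 2) (of_int a) 0"
    using flow_vol_nonneg assms by (simp add: measure_def)
  \<comment> \<open>The dimension is \<open>(3 * n - 4) - n\<close>, the number of free
    coordinates.\<close>
  moreover have "card ?E - n = ?d" using card_arcs_caracol[OF assms(1)] assms(1) by simp
  ultimately have "flow_polytope_volume n (caracol n) ?a =
      fact ?d * flow_vol (of_int b) (n - 2) (of_int a) 0"
    by (simp add: flow_polytope_volume_def normalized_volume_def v_def p_def Let_def)
  also have "\<dots> = catalan (n - 2) * of_int a ^ (n - 2) * (of_int a + (real (n - 2) + 1) * of_int b) ^ (n - 2)"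
    using flow_vol_catalan[of "of_int a" "of_int b" "n - 2"] assms by (simp add: catalan_def)
  also have "real (n - 2) + 1 = real n - 1" using assms(1) by simp
  finally show ?thesis .
qed

end
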